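(* Let $n\ge1$ be an integer, let $a<b$ be real numbers, and let $f:[a,b]\to\mathbb{R}$ be such that $f^{(n-1)}$ exists and is continuous on $[a,b]$. Let $c\in\mathbb{R}$ be such that $p_n+c$ has a real root in $[0,1]$. Then $$\left|E_{(a,b)}(p_n+c,f)\right| \le (b-a)^n\,\|f^{(n)}\|_{\mathcal{A}_c}\,V_{[0,1]}p_n .$$
   Context: The Bernoulli polynomials $B_n(x)$ are defined by $B_0(x)=1$ and, for $n\ge1$, $\frac{d}{dx}B_n(x)=nB_{n-1}(x)$ together with $\int_0^1 B_n(x)\,dx=0$. Put $p_n(x)=B_n(x)/n!$. $V_{[0,1]}g$ is the total variation of $g$ on $[0,1]$. Distributional Denjoy integral: if a distribution $g$ on $[a,b]$ is the distributional derivative of a continuous function $G:[a,b]\to\mathbb{R}$, then $\int_a^b g=G(b)-G(a)$, and for $w:[a,b]\to\mathbb{R}$ of bounded variation, $\int_a^b g\,w=G(b)w(b)-G(a)w(a)-\int_a^b G\,dw$ (Riemann–Stieltjes integral). The Alexiewicz norm is $\|g\|_{\mathcal{A}_c}=\max_{x,y\in[a,b]}|G(x)-G(y)|$. When $f^{(n-1)}$ is merely continuous, $f^{(n)}$ denotes its distributional derivative, so $\|f^{(n)}\|_{\mathcal{A}_c}=\max_{x,y\in[a,b]}|f^{(n-1)}(x)-f^{(n-1)}(y)|$. For a polynomial $p$ of degree $n$ with leading coefficient $1/n!$ the error term is $$E_{(a,b)}(p,f)=(-1)^n(b-a)^{n+1}\int_0^1 p(x)f^{(n)}\big(a+(b-a)x\big)\,dx$$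 in the distributional Denjoy sense, where $x\mapsto f^{(n)}(a+(b-a)x)$ is the distributional derivative of $x\mapsto f^{(n-1)}(a+(b-a)x)/(b-a)$; explicitly, $$E_{(a,b)}(p,f)=(-1)^n(b-a)^{n}\Big[p(1)f^{(n-1)}(b)-p(0)f^{(n-1)}(a)-\int_0^1 f^{(n-1)}\big(a+(b-a)x\big)\,p'(x)\,dx\Big].$$ *)

theory Defs
  imports "HOL-Analysis.Analysis" "HOL-Computational_Algebra.Computational_Algebra"
begin

section \<open>Bernoulli polynomials\<close>

definition bernoulli_system :: "(nat \<Rightarrow> real poly) \<Rightarrow> bool" where
  "bernoulli_system B \<longleftrightarrow> B 0 = 1 \<and>
     (\<forall>n\<ge>1. pderiv (B n) = smult (of_nat n) (B (n - 1)) \<and> integral {0..1} (poly (B n)) = 0)"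

definition bernpoly :: "nat \<Rightarrow> real poly" where
  "bernpoly = (THE B. bernoulli_system B)"

definition normalized_bernpoly :: "nat \<Rightarrow> real poly" where
  "normalized_bernpoly n = smult (1 / fact n) (bernpoly n)"

lemma poly_integrable_on [simp]: "poly (p :: real poly) integrable_on {a..b}"
  by (intro integrable_continuous_interval continuous_intros)

lemma ex_pderiv_eq: "\<exists>q :: real poly. pderiv q = p"
proof
  have "pderiv (\<Sum>i\<le>degree p. monom (coeff p i / real (Suc i)) (Suc i))
      = (\<Sum>i\<le>degree p. monom (coeff p i) i)"
    by (simp add: higher_pderiv_sum[where n = 1, simplified] pderiv_monom del: of_nat_Suc)
  then show "pderiv (\<Sum>i\<le>degree p. monom (coeff p i / real (Suc i)) (Suc i)) = p"
    by (simp add: poly_as_sum_of_monoms)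
qed

lemma ex1_pderiv_eq_integral_0:
  "\<exists>!q :: real poly. pderiv q = p \<and> integral {0..1} (poly q) = 0"
proof -
  obtain q where q: "pderiv q = p" using ex_pderiv_eq by blast
  define r where "r = q - [:integral {0..1} (poly q):]"
  have "poly r = (\<lambda>x. poly q x - integral {0..1} (poly q))"
    by (auto simp: r_def)
  then have "integral {0..1} (poly r) = 0"
    by (simp add: Henstock_Kurzweil_Integration.integral_diff integrable_const_ivl)
  moreover have "pderiv r = p" using q by (simp add: r_def pderiv_diff pderiv_pCons)
  moreover have "s = r" if s: "pderiv s = p" "integral {0..1} (poly s) = 0" for s
  proof -
    have "pderiv (s - r) = 0" using s \<open>pderiv r = p\<close> by (simp add: pderiv_diff)
    then have "degree (s - r) = 0" by (simp add: pderiv_eq_0_iff)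
    then obtain c where c: "s - r = [:c:]" by (metis degree_eq_zeroE)
    have "poly s = (\<lambda>x. poly r x + c)"
      using c by (metis (no_types) add.commute diff_add_cancel mult_zero_right add_0_right poly_add poly_pCons poly_0)
    then have "integral {0..1} (poly s) = integral {0..1} (poly r) + c"
      by (simp add: Henstock_Kurzweil_Integration.integral_add integrable_const_ivl)
    then show ?thesis using s \<open>integral {0..1} (poly r) = 0\<close> c by simp
  qed
  ultimately show ?thesis by blast
qed

lemma ex1_bernoulli_system: "\<exists>!B. bernoulli_system B"
proof -
  define step :: "nat \<Rightarrow> real poly \<Rightarrow> real poly" where
    "step n p = (THE q. pderiv q = smult (of_nat (Suc n)) p \<and> integral {0..1} (poly q) = 0)" for n p
  have step: "pderiv q = smult (of_nat (Suc n)) p \<and> integral {0..1} (poly q) = 0 \<longleftrightarrow> q = step n p"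
    for n p q
  proof -
    have "pderiv (step n p) = smult (of_nat (Suc n)) p \<and> integral {0..1} (poly (step n p)) = 0"
      unfolding step_def by (rule theI'[OF ex1_pderiv_eq_integral_0])
    then show ?thesis using ex1_pderiv_eq_integral_0 by blast
  qed
  have iff: "bernoulli_system B \<longleftrightarrow> B 0 = 1 \<and> (\<forall>n. B (Suc n) = step n (B n))" for B
    unfolding bernoulli_system_def step[symmetric]
    by (metis One_nat_def Suc_le_D diff_Suc_1 le_add1 plus_1_eq_Suc)
  define B where "B = rec_nat 1 step"
  have "bernoulli_system B" by (simp add: iff B_def)
  moreover have "C = B" if "bernoulli_system C" for C
  proof
    show "C n = B n" for n using that unfolding iff by (induction n) (auto simp: B_def)
  qed
  ultimately show ?thesis by blast
qed

lemma bernoulli_system_bernpoly: "bernoulli_system bernpoly"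
  unfolding bernpoly_def by (rule theI'[OF ex1_bernoulli_system])

lemma degree_lead_coeff_bernpoly: "degree (bernpoly n) = n \<and> lead_coeff (bernpoly n) = 1"
proof (induction n)
  case 0
  then show ?case using bernoulli_system_bernpoly by (simp add: bernoulli_system_def)
next
  case (Suc n)
  have d: "pderiv (bernpoly (Suc n)) = smult (of_nat (Suc n)) (bernpoly n)"
    using bernoulli_system_bernpoly by (auto simp: bernoulli_system_def)
  then have "pderiv (bernpoly (Suc n)) \<noteq> 0" using Suc by (auto simp del: of_nat_Suc)
  then have "degree (bernpoly (Suc n)) \<noteq> 0" by (simp add: pderiv_eq_0_iff)
  moreover have "degree (bernpoly (Suc n)) - 1 = n"
    using Suc d by (metis degree_pderiv degree_smult_eq of_nat_eq_0_iff nat.distinct(1))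
  ultimately have deg: "degree (bernpoly (Suc n)) = Suc n" by simp
  have "coeff (pderiv (bernpoly (Suc n))) n = of_nat (Suc n)"
    unfolding d using Suc.IH by (metis coeff_smult mult.right_neutral)
  then have "coeff (bernpoly (Suc n)) (Suc n) = 1" by (simp add: coeff_pderiv del: of_nat_Suc)
  then show ?case using deg by simp
qed

lemma degree_normalized_bernpoly_plus:
  "n \<ge> 1 \<Longrightarrow> degree (normalized_bernpoly n + [:c:]) = n"
  using degree_lead_coeff_bernpoly[of n]
  by (subst degree_add_eq_left) (auto simp: normalized_bernpoly_def)

lemma lead_coeff_normalized_bernpoly_plus:
  "n \<ge> 1 \<Longrightarrow> lead_coeff (normalized_bernpoly n + [:c:]) = 1 / fact n"
  using degree_lead_coeff_bernpoly[of n] 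
  unfolding degree_normalized_bernpoly_plus
  by (auto simp: normalized_bernpoly_def coeff_pCons split: nat.splits)


section \<open>Total variation and the Riemann-Stieltjes integral\<close>

definition partition_of_interval :: "real \<Rightarrow> real \<Rightarrow> nat \<Rightarrow> (nat \<Rightarrow> real) \<Rightarrow> bool" where
  "partition_of_interval a b N t \<longleftrightarrow> t 0 = a \<and> t N = b \<and> (\<forall>i<N. t i < t (Suc i))"

text \<open>As a supremum in \<^typ>\<open>real\<close>, this is meaningful only for functions of bounded variation,
  such as polynomials.\<close>

definition total_variation :: "real \<Rightarrow> real \<Rightarrow> (real \<Rightarrow> real) \<Rightarrow> real" where
  "total_variation a b g =
     Sup {\<Sum>i<N. \<bar>g (t (Suc i)) - g (t i)\<bar> | N t. partition_of_interval a b N t}"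

definition has_rs_integral ::
    "(real \<Rightarrow> real) \<Rightarrow> (real \<Rightarrow> real) \<Rightarrow> real \<Rightarrow> real \<Rightarrow> real \<Rightarrow> bool" where
  "has_rs_integral G w a b I \<longleftrightarrow>
     (\<forall>\<epsilon>>0. \<exists>\<delta>>0. \<forall>N t s.
        partition_of_interval a b N t \<and>
        (\<forall>i<N. t (Suc i) - t i < \<delta> \<and> s i \<in> {t i..t (Suc i)}) \<longrightarrow>
        \<bar>(\<Sum>i<N. G (s i) * (w (t (Suc i)) - w (t i))) - I\<bar> < \<epsilon>)"

definition rs_integral :: "(real \<Rightarrow> real) \<Rightarrow> (real \<Rightarrow> real) \<Rightarrow> real \<Rightarrow> real \<Rightarrow> real" where
  "rs_integral G w a b = (THE I. has_rs_integral G w a b I)"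

lemma partition_of_interval_mono:
  assumes "partition_of_interval a b N t" "i \<le> j" "j \<le> N"
  shows "t i \<le> t j"
  using assms(2,3)
proof (induction j rule: dec_induct)
  case (step m)
  have "t m < t (Suc m)" using step assms(1) by (simp add: partition_of_interval_def)
  then show ?case using step by simp
qed simp

lemma ex_fine_partition:
  assumes "a < b" "\<delta> > 0"
  shows "\<exists>N t. partition_of_interval a b N t \<and> (\<forall>i<N. t (Suc i) - t i < \<delta>)"
proof -
  obtain m :: nat where "(b - a) / \<delta> < m" using reals_Archimedean2 by blast
  then have m: "(b - a) < m * \<delta>" using assms by (simp add: field_simps)
  then have "m > 0" using assms by (cases m) auto
  define t where "t i = a + (b - a) * real i / real m" for i
  have diff: "t (Suc i) - t i = (b - a) / real m" for i
    using \<open>m > 0\<close> by (simp add: t_def field_simps)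
  moreover have "0 < (b - a) / real m" "(b - a) / real m < \<delta>"
    using m \<open>m > 0\<close> assms by (auto simp: field_simps)
  ultimately have "t i < t (Suc i)" "t (Suc i) - t i < \<delta>" for i
    by (metis diff_gt_0_iff_gt) (use diff \<open>(b - a) / real m < \<delta>\<close> in simp)
  moreover have "t 0 = a" "t m = b" using \<open>m > 0\<close> by (auto simp: t_def)
  ultimately have "partition_of_interval a b m t \<and> (\<forall>i<m. t (Suc i) - t i < \<delta>)"
    by (auto simp: partition_of_interval_def)
  then show ?thesis by blast
qed

lemma has_rs_integral_unique:
  assumes "a < b" "has_rs_integral G w a b I" "has_rs_integral G w a b J"
  shows "I = J"
proof (rule ccontr)
  assume "I \<noteq> J"
  then have pos: "\<bar>I - J\<bar> / 2 > 0" by simp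
  obtain d where d: "d > 0" "\<And>N t s. partition_of_interval a b N t \<and>
        (\<forall>i<N. t (Suc i) - t i < d \<and> s i \<in> {t i..t (Suc i)}) \<Longrightarrow>
        \<bar>(\<Sum>i<N. G (s i) * (w (t (Suc i)) - w (t i))) - I\<bar> < \<bar>I - J\<bar> / 2"
    using assms(2) pos unfolding has_rs_integral_def by meson
  obtain e where e: "e > 0" "\<And>N t s. partition_of_interval a b N t \<and>
        (\<forall>i<N. t (Suc i) - t i < e \<and> s i \<in> {t i..t (Suc i)}) \<Longrightarrow>
        \<bar>(\<Sum>i<N. G (s i) * (w (t (Suc i)) - w (t i))) - J\<bar> < \<bar>I - J\<bar> / 2"
    using assms(3) pos unfolding has_rs_integral_def by meson
  obtain N t where t: "partition_of_interval a b N t" "\<And>i. i < N \<Longrightarrow> t (Suc i) - t i < min d e"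
    using ex_fine_partition[OF assms(1), of "min d e"] d(1) e(1) by auto
  have "t i \<in> {t i..t (Suc i)}" if "i < N" for i
    using t(1) that by (auto simp: partition_of_interval_def less_imp_le)
  then have "\<bar>(\<Sum>i<N. G (t i) * (w (t (Suc i)) - w (t i))) - I\<bar> < \<bar>I - J\<bar> / 2"
       "\<bar>(\<Sum>i<N. G (t i) * (w (t (Suc i)) - w (t i))) - J\<bar> < \<bar>I - J\<bar> / 2"
    using t d(2)[of N t t] e(2)[of N t t] by auto
  then show False by (auto simp: abs_if split: if_splits)
qed

lemma rs_integralI: "a < b \<Longrightarrow> has_rs_integral G w a b I \<Longrightarrow> rs_integral G w a b = I"
  unfolding rs_integral_def by (blast intro: has_rs_integral_unique)

lemma integral_partition_of_interval:
  fixes f :: "real \<Rightarrow> real"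
  assumes "partition_of_interval a b N t" "f integrable_on {a..b}"
  shows "integral {a..b} f = (\<Sum>i<N. integral {t i..t (Suc i)} f)"
proof -
  have "integral {a..t j} f = (\<Sum>i<j. integral {t i..t (Suc i)} f)" if "j \<le> N" for j
    using that
  proof (induction j)
    case 0
    then show ?case using assms by (simp add: partition_of_interval_def)
  next
    case (Suc j)
    have "a \<le> t j" "t j \<le> t (Suc j)" "t (Suc j) \<le> b"
      using partition_of_interval_mono[OF assms(1), of 0 j]
        partition_of_interval_mono[OF assms(1), of j "Suc j"]
        partition_of_interval_mono[OF assms(1), of "Suc j" N] Suc.prems assms(1)
      by (auto simp: partition_of_interval_def)
    then have "integral {a..t j} f + integral {t j..t (Suc j)} f = integral {a..t (Suc j)} f"
      by (intro Henstock_Kurzweil_Integration.integral_combine)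
         (auto intro: integrable_on_subinterval[OF assms(2)])
    then show ?case using Suc by simp
  qed
  then show ?thesis using assms(1) by (auto simp: partition_of_interval_def)
qed

lemma has_rs_integral_C1:
  assumes "a < b" and G: "continuous_on {a..b} G" and w': "continuous_on {a..b} w'"
    and w: "\<And>x. x \<in> {a..b} \<Longrightarrow> (w has_real_derivative w' x) (at x within {a..b})"
  shows "has_rs_integral G w a b (integral {a..b} (\<lambda>x. G x * w' x))"
  unfolding has_rs_integral_def
proof (intro allI impI)
  fix \<epsilon> :: real assume "\<epsilon> > 0"
  obtain M where M: "M > 0" "\<And>x. x \<in> {a..b} \<Longrightarrow> \<bar>w' x\<bar> \<le> M"
    using compact_imp_bounded[OF compact_continuous_image[OF w']] unfolding bounded_pos by auto
  define \<eta> where "\<eta> = \<epsilon> / (2 * M * (b - a))"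
  have "\<eta> > 0" using \<open>\<epsilon> > 0\<close> M \<open>a < b\<close> by (simp add: \<eta>_def)
  obtain \<delta> where \<delta>: "\<delta> > 0"
    "\<And>x y. x \<in> {a..b} \<Longrightarrow> y \<in> {a..b} \<Longrightarrow> \<bar>y - x\<bar> < \<delta> \<Longrightarrow> \<bar>G y - G x\<bar> < \<eta>"
    using compact_uniformly_continuous[OF G] \<open>\<eta> > 0\<close>
    unfolding uniformly_continuous_on_def dist_real_def by (metis compact_Icc)
  have "\<bar>(\<Sum>i<N. G (s i) * (w (t (Suc i)) - w (t i))) - integral {a..b} (\<lambda>x. G x * w' x)\<bar> < \<epsilon>"
    if t: "partition_of_interval a b N t"
      and s: "\<And>i. i < N \<Longrightarrow> t (Suc i) - t i < \<delta> \<and> s i \<in> {t i..t (Suc i)}" for N t s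
  proof -
    have sub: "{t i..t (Suc i)} \<subseteq> {a..b}" and le: "t i \<le> t (Suc i)" if "i < N" for i
      using partition_of_interval_mono[OF t, of 0 i]
        partition_of_interval_mono[OF t, of i "Suc i"]
        partition_of_interval_mono[OF t, of "Suc i" N] that t
      by (auto simp: partition_of_interval_def)
    have int: "(\<lambda>x. G x * w' x) integrable_on {a..b}"
      by (intro integrable_continuous_interval continuous_intros G w')
    have "\<bar>G (s i) * (w (t (Suc i)) - w (t i)) - integral {t i..t (Suc i)} (\<lambda>x. G x * w' x)\<bar>
        \<le> (\<eta> * M) * (t (Suc i) - t i)" if i: "i < N" for i
    proof -
      have "(w' has_integral (w (t (Suc i)) - w (t i))) {t i..t (Suc i)}"
        using sub[OF i] le[OF i]
        by (intro fundamental_theorem_of_calculus)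
           (auto simp flip: has_real_derivative_iff_has_vector_derivative
             intro!: DERIV_subset[OF w])
      then have 1: "((\<lambda>x. G (s i) * w' x) has_integral G (s i) * (w (t (Suc i)) - w (t i)))
          {t i..t (Suc i)}"
        by (rule has_integral_mult_right)
      have 2: "((\<lambda>x. G x * w' x) has_integral integral {t i..t (Suc i)} (\<lambda>x. G x * w' x))
          {t i..t (Suc i)}"
        using integrable_on_subinterval[OF int sub[OF i]] by blast
      have 3: "((\<lambda>x. G (s i) * w' x - G x * w' x) has_integral
          (G (s i) * (w (t (Suc i)) - w (t i)) - integral {t i..t (Suc i)} (\<lambda>x. G x * w' x)))
          (cbox (t i) (t (Suc i)))"
        using has_integral_diff[OF 1 2] by (simp add: cbox_interval)
      have "norm (G (s i) * w' x - G x * w' x) \<le> \<eta> * M" if "x \<in> cbox (t i) (t (Suc i))" for x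
      proof -
        have x: "x \<in> {t i..t (Suc i)}" using that by simp
        then have "x \<in> {a..b}" "s i \<in> {a..b}" using sub[OF i] s[OF i] by blast+
        moreover have "\<bar>s i - x\<bar> < \<delta>" using x s[OF i] by auto
        ultimately have "\<bar>G (s i) - G x\<bar> \<le> \<eta>" "\<bar>w' x\<bar> \<le> M" using \<delta>(2) M(2) less_imp_le by blast+
        then have "\<bar>G (s i) - G x\<bar> * \<bar>w' x\<bar> \<le> \<eta> * M"
          using \<open>\<eta> > 0\<close> by (intro mult_mono) auto
        then show ?thesis by (simp add: left_diff_distrib flip: abs_mult)
      qed
      from has_integral_bound[OF _ 3 this] show ?thesis
        using \<open>\<eta> > 0\<close> M(1) le[OF i] by simp
    qed
    then have "(\<Sum>i<N. \<bar>G (s i) * (w (t (Suc i)) - w (t i)) -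
          integral {t i..t (Suc i)} (\<lambda>x. G x * w' x)\<bar>) \<le> (\<Sum>i<N. (\<eta> * M) * (t (Suc i) - t i))"
      by (intro sum_mono) auto
    also have "\<dots> = \<eta> * M * (b - a)"
      using t by (simp add: sum_lessThan_telescope partition_of_interval_def flip: sum_distrib_left)
    also have "\<dots> < \<epsilon>" using \<open>\<epsilon> > 0\<close> M(1) \<open>a < b\<close> by (simp add: \<eta>_def divide_simps)
    finally show ?thesis
      using integral_partition_of_interval[OF t int]
        sum_abs[of "\<lambda>i. G (s i) * (w (t (Suc i)) - w (t i)) -
          integral {t i..t (Suc i)} (\<lambda>x. G x * w' x)" "{..<N}"]
      by (simp add: sum_subtractf)
  qed
  then show "\<exists>\<delta>>0. \<forall>N t s. partition_of_interval a b N t \<and>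
        (\<forall>i<N. t (Suc i) - t i < \<delta> \<and> s i \<in> {t i..t (Suc i)}) \<longrightarrow>
        \<bar>(\<Sum>i<N. G (s i) * (w (t (Suc i)) - w (t i))) - integral {a..b} (\<lambda>x. G x * w' x)\<bar> < \<epsilon>"
    using \<delta>(1) by blast
qed


section \<open>Distributions on an interval and the Denjoy integral\<close>

text \<open>A distribution on $[a,b]$ is represented by its action on test functions; its values on other
  functions carry no meaning.\<close>

definition test_functions :: "real \<Rightarrow> real \<Rightarrow> (real \<Rightarrow> real) set" where
  "test_functions a b = {\<phi>. (\<forall>k. (deriv ^^ k) \<phi> differentiable_on UNIV) \<and>
     (\<exists>c d. a < c \<and> c < d \<and> d < b \<and> (\<forall>x. x \<notin> {c..d} \<longrightarrow> \<phi> x = 0))}"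

definition distr_deriv ::
    "real \<Rightarrow> real \<Rightarrow> (real \<Rightarrow> real) \<Rightarrow> (real \<Rightarrow> real) \<Rightarrow> real" where
  "distr_deriv a b G = (\<lambda>\<phi>. - integral {a..b} (\<lambda>x. G x * deriv \<phi> x))"

definition is_distr_primitive ::
    "real \<Rightarrow> real \<Rightarrow> ((real \<Rightarrow> real) \<Rightarrow> real) \<Rightarrow> (real \<Rightarrow> real) \<Rightarrow> bool" where
  "is_distr_primitive a b g G \<longleftrightarrow>
     continuous_on {a..b} G \<and> (\<forall>\<phi>\<in>test_functions a b. g \<phi> = distr_deriv a b G \<phi>)"

text \<open>Primitives are unique up to an additive constant (shown below), and neither the integral nor
  the norm depends on it.\<close>

definition distr_primitive ::
    "real \<Rightarrow> real \<Rightarrow> ((real \<Rightarrow> real) \<Rightarrow> real) \<Rightarrow> real \<Rightarrow> real" where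
  "distr_primitive a b g = (SOME G. is_distr_primitive a b g G)"

definition denjoy_integral ::
    "real \<Rightarrow> real \<Rightarrow> ((real \<Rightarrow> real) \<Rightarrow> real) \<Rightarrow> (real \<Rightarrow> real) \<Rightarrow> real" where
  "denjoy_integral a b g w =
     (let G = distr_primitive a b g in G b * w b - G a * w a - rs_integral G w a b)"

definition alexiewicz_norm :: "real \<Rightarrow> real \<Rightarrow> ((real \<Rightarrow> real) \<Rightarrow> real) \<Rightarrow> real" where
  "alexiewicz_norm a b g =
     (let G = distr_primitive a b g in Sup {\<bar>G x - G y\<bar> | x y. x \<in> {a..b} \<and> y \<in> {a..b}})"

subsection \<open>Uniqueness of primitives\<close>

definition flat :: "real poly \<Rightarrow> real \<Rightarrow> real" where
  "flat p x = (if x > 0 then poly p (1 / x) * exp (- (1 / x)) else 0)"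

lemma tendsto_poly_exp_0: "((\<lambda>y. poly p y * exp (- y)) \<longlongrightarrow> (0::real)) at_top"
proof -
  have "((\<lambda>y. \<Sum>i\<le>degree p. coeff p i * (y ^ i / exp y)) \<longlongrightarrow> (\<Sum>i\<le>degree p. coeff p i * 0)) at_top"
    by (intro tendsto_intros tendsto_power_div_exp_0)
  then show ?thesis by (simp add: poly_altdef exp_minus divide_inverse sum_distrib_right mult.assoc)
qed

lemma tendsto_flat_0: "(flat p \<longlongrightarrow> 0) (at 0)"
proof (rule filterlim_split_at)
  show "(flat p \<longlongrightarrow> 0) (at_left 0)"
    by (rule tendsto_eventually) (auto simp: flat_def eventually_at_filter)
  have "((\<lambda>x. poly p (inverse x) * exp (- (inverse x))) \<longlongrightarrow> 0) (at_right 0)"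
    by (rule filterlim_compose[OF tendsto_poly_exp_0 filterlim_inverse_at_top_right])
  then show "(flat p \<longlongrightarrow> 0) (at_right 0)"
    by (rule Lim_transform_eventually)
       (auto simp: flat_def eventually_at_filter inverse_eq_divide)
qed

lemma flat_has_derivative:
  "(flat p has_real_derivative flat ([:0, 0, 1:] * (p - pderiv p)) x) (at x)"
proof (cases x "0 :: real" rule: linorder_cases)
  case less
  have "((\<lambda>_. 0) has_real_derivative 0) (at x)" by simp
  then have "(flat p has_real_derivative 0) (at x)"
    by (rule has_field_derivative_transform_within_open[of _ _ _ "{..<0}"])
       (use less in \<open>auto simp: flat_def\<close>)
  then show ?thesis using less by (simp add: flat_def)
next
  case equal
  have "(\<lambda>h. flat p h / h) = flat (pCons 0 p)" by (auto simp: flat_def)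
  then have "((\<lambda>h. flat p h / h) \<longlongrightarrow> 0) (at 0)" using tendsto_flat_0 by simp
  then show ?thesis using equal by (simp add: DERIV_def flat_def)
next
  case greater
  have "((\<lambda>x. poly p (1 / x) * exp (- (1 / x))) has_real_derivative
      poly ([:0, 0, 1:] * (p - pderiv p)) (1 / x) * exp (- (1 / x))) (at x)"
    using greater
    by (auto intro!: derivative_eq_intros DERIV_chain2[OF poly_DERIV]
        simp: field_simps power2_eq_square)
  then have "(flat p has_real_derivative
      poly ([:0, 0, 1:] * (p - pderiv p)) (1 / x) * exp (- (1 / x))) (at x)"
    by (rule has_field_derivative_transform_within_open[of _ _ _ "{0<..}"])
       (use greater in \<open>auto simp: flat_def\<close>)
  then show ?thesis using greater by (simp add: flat_def)
qed

text \<open>A class of smooth functions containing the bumps below and closed under derivatives.\<close>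

inductive_set flat_span :: "(real \<Rightarrow> real) set" where
  prod: "(\<lambda>t. flat p (t - u) * flat q (v - t)) \<in> flat_span"
| sum: "f \<in> flat_span \<Longrightarrow> g \<in> flat_span \<Longrightarrow> (\<lambda>t. f t + g t) \<in> flat_span"

lemma flat_span_deriv:
  "f \<in> flat_span \<Longrightarrow> \<exists>f'\<in>flat_span. \<forall>x. (f has_real_derivative f' x) (at x)"
proof (induction rule: flat_span.induct)
  case (prod p u q v)
  define p' q' where "p' = [:0, 0, 1:] * (p - pderiv p)" and "q' = - [:0, 0, 1:] * (q - pderiv q)"
  have "flat q' y = - flat ([:0, 0, 1:] * (q - pderiv q)) y" for y
    by (simp add: q'_def flat_def algebra_simps add_divide_distrib diff_divide_distrib)
  then have "((\<lambda>t. flat p (t - u) * flat q (v - t)) has_real_derivative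
      flat p' (x - u) * flat q (v - x) + flat p (x - u) * flat q' (v - x)) (at x)" for x
    unfolding p'_def
    by (auto intro!: derivative_eq_intros DERIV_chain2[OF flat_has_derivative])
  moreover have "(\<lambda>x. flat p' (x - u) * flat q (v - x) + flat p (x - u) * flat q' (v - x)) \<in> flat_span"
    by (intro flat_span.intros)
  ultimately show ?case by (intro bexI allI)
next
  case (sum f g)
  then obtain f' g' where "f' \<in> flat_span" "g' \<in> flat_span"
      "\<And>x. (f has_real_derivative f' x) (at x)" "\<And>x. (g has_real_derivative g' x) (at x)"
    by blast
  then show ?case
    by (intro bexI[of _ "\<lambda>x. f' x + g' x"] allI DERIV_add flat_span.sum)
qed

lemma iterated_deriv_in_flat_span: "f \<in> flat_span \<Longrightarrow> (deriv ^^ k) f \<in> flat_span"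
proof (induction k)
  case (Suc k)
  obtain g where "g \<in> flat_span" "\<forall>x. ((deriv ^^ k) f has_real_derivative g x) (at x)"
    using flat_span_deriv Suc by blast
  moreover from this have "deriv ((deriv ^^ k) f) = g" by (blast intro: DERIV_imp_deriv)
  ultimately show ?case by simp
qed simp

lemma flat_span_differentiable: "f \<in> flat_span \<Longrightarrow> f differentiable_on UNIV"
  using flat_span_deriv
  by (metis differentiable_on_def differentiable_at_withinI real_differentiable_def)

lemma ex_antiderivative:
  fixes f :: "real \<Rightarrow> real"
  assumes "continuous_on UNIV f"
  shows "\<exists>F. \<forall>x. (F has_real_derivative f x) (at x)"
proof (intro exI allI)
  fix x :: real
  let ?l = "min 0 x - 1" and ?r = "max 0 x + 1"
  have "((\<lambda>u. LBINT y=ereal 0..ereal u. f y) has_vector_derivative f x) (at x within {?l..?r})"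
    by (rule interval_integral_FTC2) (auto intro: continuous_on_subset[OF assms])
  then show "((\<lambda>u. LBINT y=ereal 0..ereal u. f y) has_real_derivative f x) (at x)"
    unfolding has_real_derivative_iff_has_vector_derivative
    by (subst (asm) at_within_interior) auto
qed

lemma ex_bump_difference:
  assumes "a < x - \<delta>" "x + \<delta> < y - \<delta>" "y + \<delta> < b" "\<delta> > 0"
  shows "\<exists>\<phi>\<in>test_functions a b. (\<forall>t. (\<phi> has_real_derivative deriv \<phi> t) (at t)) \<and>
     continuous_on UNIV (deriv \<phi>) \<and>
     deriv \<phi> x > 0 \<and> (\<forall>t. \<bar>t - x\<bar> < \<delta> \<longrightarrow> deriv \<phi> t \<ge> 0) \<and> (\<forall>t. \<bar>t - y\<bar> < \<delta> \<longrightarrow> deriv \<phi> t \<le> 0) \<and>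
     (\<forall>t. \<bar>t - x\<bar> \<ge> \<delta> \<longrightarrow> \<bar>t - y\<bar> \<ge> \<delta> \<longrightarrow> deriv \<phi> t = 0)"
proof -
  define \<rho> where "\<rho> t = flat 1 (t + \<delta>) * flat 1 (\<delta> - t)" for t
  have \<rho>: "\<rho> t \<ge> 0" "\<rho> t > 0 \<longleftrightarrow> \<bar>t\<bar> < \<delta>" "\<bar>t\<bar> \<ge> \<delta> \<Longrightarrow> \<rho> t = 0" for t
    by (auto simp: \<rho>_def flat_def)
  have \<rho>_in: "\<rho> \<in> flat_span"
    using flat_span.prod[of 1 "-\<delta>" 1 \<delta>] by (simp add: \<rho>_def[abs_def])
  then have "continuous_on UNIV \<rho>"
    by (intro differentiable_imp_continuous_on flat_span_differentiable)
  then obtain R where R: "\<And>t. (R has_real_derivative \<rho> t) (at t)"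
    using ex_antiderivative by blast
  have R_le: "R t = R (-\<delta>)" if "t \<le> -\<delta>" for t
  proof (rule has_field_derivative_zero_constant[of "{..-\<delta>}" R, THEN exE])
    show "(R has_real_derivative 0) (at s within {..-\<delta>})" if "s \<in> {..-\<delta>}" for s
      using R[of s] \<rho>(3)[of s] that by (auto intro: has_field_derivative_at_within)
  qed (use that in auto)
  have R_ge: "R t = R \<delta>" if "t \<ge> \<delta>" for t
  proof (rule has_field_derivative_zero_constant[of "{\<delta>..}" R, THEN exE])
    show "(R has_real_derivative 0) (at s within {\<delta>..})" if "s \<in> {\<delta>..}" for s
      using R[of s] \<rho>(3)[of s] that by (auto intro: has_field_derivative_at_within)
  qed (use that in auto)
  define \<phi> where "\<phi> t = R (t - x) - R (t - y)" for t
  define \<psi> where "\<psi> t = \<rho> (t - x) - \<rho> (t - y)" for t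
  have der: "(\<phi> has_real_derivative \<psi> t) (at t)" for t
    unfolding \<phi>_def \<psi>_def by (auto intro!: derivative_eq_intros DERIV_chain2[OF R])
  then have d: "deriv \<phi> = \<psi>" by (blast intro: DERIV_imp_deriv)
  have "\<psi> = (\<lambda>t. flat 1 (t - (x - \<delta>)) * flat 1 (x + \<delta> - t) +
      flat (-1) (t - (y - \<delta>)) * flat 1 (y + \<delta> - t))"
    by (auto simp: \<psi>_def \<rho>_def flat_def fun_eq_iff algebra_simps)
  then have \<psi>_in: "\<psi> \<in> flat_span" by (simp only: flat_span.intros)
  have "(deriv ^^ k) \<phi> differentiable_on UNIV" for k
  proof (cases k)
    case 0
    then show ?thesis using der
      by (auto simp: differentiable_on_def real_differentiable_def intro!: differentiable_at_withinI)
  next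
    case (Suc m)
    then have "(deriv ^^ k) \<phi> = (deriv ^^ m) \<psi>"
      by (simp only: Suc funpow_Suc_right o_apply d)
    then show ?thesis using flat_span_differentiable iterated_deriv_in_flat_span \<psi>_in by metis
  qed
  moreover have "\<phi> t = 0" if "t \<notin> {x - \<delta>..y + \<delta>}" for t
  proof (cases "t < x - \<delta>")
    case True
    then show ?thesis using assms R_le[of "t - x"] R_le[of "t - y"] by (simp add: \<phi>_def)
  next
    case False
    then show ?thesis using assms that R_ge[of "t - x"] R_ge[of "t - y"] by (simp add: \<phi>_def)
  qed
  ultimately have "\<phi> \<in> test_functions a b"
    using assms unfolding test_functions_def
    by (intro CollectI conjI allI exI[of _ "x - \<delta>"] exI[of _ "y + \<delta>"]) auto
  moreover have "continuous_on UNIV \<psi>"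
    using \<psi>_in by (intro differentiable_imp_continuous_on flat_span_differentiable)
  moreover have "\<psi> x > 0" using \<rho>(2)[of 0] \<rho>(3)[of "x - y"] assms by (auto simp: \<psi>_def)
  moreover have "\<psi> t \<ge> 0" if "\<bar>t - x\<bar> < \<delta>" for t
    using \<rho>(1)[of "t - x"] \<rho>(3)[of "t - y"] assms that by (auto simp: \<psi>_def)
  moreover have "\<psi> t \<le> 0" if "\<bar>t - y\<bar> < \<delta>" for t
    using \<rho>(1)[of "t - y"] \<rho>(3)[of "t - x"] assms that by (auto simp: \<psi>_def)
  moreover have "\<psi> t = 0" if "\<bar>t - x\<bar> \<ge> \<delta>" "\<bar>t - y\<bar> \<ge> \<delta>" for t
    using that \<rho>(3) by (simp add: \<psi>_def)
  ultimately show ?thesis using der unfolding d[symmetric] by blast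
qed

lemma distr_deriv_zero_aux:
  assumes G: "continuous_on {a..b} G" and "a < x" "x < y" "y < b"
    and zero: "\<And>\<phi>. \<phi> \<in> test_functions a b \<Longrightarrow> distr_deriv a b G \<phi> = 0"
  shows "G x \<ge> G y"
proof (rule ccontr)
  assume "\<not> G x \<ge> G y"
  define m where "m = (G x + G y) / 2"
  have m: "G x < m" "m < G y" using \<open>\<not> G x \<ge> G y\<close> by (auto simp: m_def)
  obtain d1 where d1: "d1 > 0" "\<And>t. t \<in> {a..b} \<Longrightarrow> \<bar>t - x\<bar> < d1 \<Longrightarrow> \<bar>G t - G x\<bar> < m - G x"
    using G[unfolded continuous_on_iff dist_real_def, rule_format, of x "m - G x"] m assms by auto
  obtain d2 where d2: "d2 > 0" "\<And>t. t \<in> {a..b} \<Longrightarrow> \<bar>t - y\<bar> < d2 \<Longrightarrow> \<bar>G t - G y\<bar> < G y - m"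
    using G[unfolded continuous_on_iff dist_real_def, rule_format, of y "G y - m"] m assms by auto
  define \<delta> where "\<delta> = Min {d1, d2, x - a, (y - x) / 2, b - y} / 2"
  have "Min {d1, d2, x - a, (y - x) / 2, b - y} > 0" using d1 d2 assms by simp
  then have \<delta>: "\<delta> > 0" "\<delta> < d1" "\<delta> < d2" "\<delta> < x - a" "\<delta> < (y - x) / 2" "\<delta> < b - y"
    unfolding \<delta>_def by (auto simp: min_def split: if_splits)
  obtain \<phi> where \<phi>: "\<phi> \<in> test_functions a b" "\<And>t. (\<phi> has_real_derivative deriv \<phi> t) (at t)"
     "continuous_on UNIV (deriv \<phi>)" "deriv \<phi> x > 0"
     "\<And>t. \<bar>t - x\<bar> < \<delta> \<Longrightarrow> deriv \<phi> t \<ge> 0" "\<And>t. \<bar>t - y\<bar> < \<delta> \<Longrightarrow> deriv \<phi> t \<le> 0"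
     "\<And>t. \<bar>t - x\<bar> \<ge> \<delta> \<Longrightarrow> \<bar>t - y\<bar> \<ge> \<delta> \<Longrightarrow> deriv \<phi> t = 0"
    using ex_bump_difference[of a x \<delta> y b] \<delta> by (auto simp: field_simps)
  have cont: "continuous_on {a..b} (deriv \<phi>)" using \<phi>(3) continuous_on_subset by blast
  have "\<phi> a = 0" "\<phi> b = 0" using \<phi>(1) unfolding test_functions_def by fastforce+
  have "(deriv \<phi> has_integral \<phi> b - \<phi> a) {a..b}"
    using assms \<phi>(2)
    by (intro fundamental_theorem_of_calculus)
       (auto simp flip: has_real_derivative_iff_has_vector_derivative
         intro: has_field_derivative_at_within)
  then have 1: "(deriv \<phi> has_integral 0) {a..b}" using \<open>\<phi> a = 0\<close> \<open>\<phi> b = 0\<close> by simp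
  have 2: "((\<lambda>t. G t * deriv \<phi> t) has_integral 0) {a..b}"
  proof -
    have "(\<lambda>t. G t * deriv \<phi> t) integrable_on {a..b}"
      by (intro integrable_continuous_interval continuous_intros G cont)
    moreover have "integral {a..b} (\<lambda>t. G t * deriv \<phi> t) = 0"
      using zero[OF \<phi>(1)] by (simp add: distr_deriv_def)
    ultimately show ?thesis by (simp add: has_integral_iff)
  qed
  have 3: "((\<lambda>t. (m - G t) * deriv \<phi> t) has_integral 0) {a..b}"
    using has_integral_diff[OF has_integral_mult_right[OF 1, of m] 2] by (simp add: left_diff_distrib)
  have "(m - G t) * deriv \<phi> t \<ge> 0" if t: "t \<in> {a..b}" for t
  proof -
    consider "\<bar>t - x\<bar> < \<delta>" | "\<bar>t - y\<bar> < \<delta>" | "\<bar>t - x\<bar> \<ge> \<delta>" "\<bar>t - y\<bar> \<ge> \<delta>" by linarith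
    then show ?thesis
    proof cases
      case 1
      then have "\<bar>G t - G x\<bar> < m - G x" using d1(2)[OF t] \<delta> by simp
      then have "m - G t \<ge> 0" by simp
      then show ?thesis using \<phi>(5)[OF 1] by simp
    next
      case 2
      then have "\<bar>G t - G y\<bar> < G y - m" using d2(2)[OF t] \<delta> by simp
      then have "m - G t \<le> 0" by simp
      then show ?thesis using \<phi>(6)[OF 2] by (simp add: mult_nonpos_nonpos)
    qed (simp add: \<phi>(7))
  qed
  then have "(m - G x) * deriv \<phi> x = 0"
    using assms 3
    by (intro has_integral_0_cbox_imp_0[of a b "\<lambda>t. (m - G t) * deriv \<phi> t"] )
       (auto intro!: continuous_intros G cont)
  then show False using m \<phi>(4) by simp
qed

lemma distr_deriv_zero_imp_constant:
  assumes "a < b" and G: "continuous_on {a..b} G"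
    and zero: "\<And>\<phi>. \<phi> \<in> test_functions a b \<Longrightarrow> distr_deriv a b G \<phi> = 0"
  shows "\<exists>C. \<forall>x\<in>{a..b}. G x = C"
proof -
  have mono: "G x = G y" if "a < x" "x < y" "y < b" for x y
  proof (rule antisym)
    show "G y \<le> G x" by (rule distr_deriv_zero_aux[OF G that zero])
    have "- G x \<ge> - G y"
      using zero by (intro distr_deriv_zero_aux[of a b "\<lambda>x. - G x"] continuous_intros G that)
        (auto simp: distr_deriv_def)
    then show "G x \<le> G y" by simp
  qed
  define K where "K = G ((a + b) / 2)"
  have "G x = K" if "x \<in> {a<..<b}" for x
  proof (cases x "(a + b) / 2" rule: linorder_cases)
    case less
    then show ?thesis using that \<open>a < b\<close> unfolding K_def by (intro mono) auto
  next
    case greater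
    then have "K = G x" using that \<open>a < b\<close> unfolding K_def by (intro mono) auto
    then show ?thesis by simp
  next
    case equal
    then show ?thesis unfolding K_def by (simp only:)
  qed
  moreover have "closure {a<..<b} = {a..b}" using \<open>a < b\<close> by simp
  ultimately have "G x = K" if "x \<in> {a..b}" for x
    using continuous_constant_on_closure[of "{a<..<b}" G K x] G that by metis
  then show ?thesis by blast
qed

lemma distr_primitive_distr_deriv:
  assumes "a < b" and G: "continuous_on {a..b} G"
  shows "\<exists>C. \<forall>x\<in>{a..b}. distr_primitive a b (distr_deriv a b G) x = G x + C"
proof -
  define H where "H = distr_primitive a b (distr_deriv a b G)"
  have "is_distr_primitive a b (distr_deriv a b G) H"
    unfolding H_def distr_primitive_def
    by (rule someI[of _ G]) (simp add: is_distr_primitive_def G)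
  then have H: "continuous_on {a..b} H"
      "\<And>\<phi>. \<phi> \<in> test_functions a b \<Longrightarrow> distr_deriv a b G \<phi> = distr_deriv a b H \<phi>"
    by (auto simp: is_distr_primitive_def)
  have "distr_deriv a b (\<lambda>x. H x - G x) \<phi> = 0" if \<phi>: "\<phi> \<in> test_functions a b" for \<phi>
  proof -
    have "deriv \<phi> differentiable_on UNIV"
      using \<phi> unfolding test_functions_def by (auto dest: spec[of _ 1])
    then have "continuous_on {a..b} (deriv \<phi>)"
      using continuous_on_subset differentiable_imp_continuous_on by blast
    then have "integral {a..b} (\<lambda>x. H x * deriv \<phi> x - G x * deriv \<phi> x) =
        integral {a..b} (\<lambda>x. H x * deriv \<phi> x) - integral {a..b} (\<lambda>x. G x * deriv \<phi> x)"
      by (intro Henstock_Kurzweil_Integration.integral_diff integrable_continuous_interval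
          continuous_intros G H)
    then show ?thesis using H(2)[OF \<phi>] by (simp add: distr_deriv_def left_diff_distrib)
  qed
  then obtain C where "\<forall>x\<in>{a..b}. H x - G x = C"
    using distr_deriv_zero_imp_constant[OF \<open>a < b\<close> continuous_on_diff[OF H(1) G]] by blast
  then show ?thesis unfolding H_def by (intro exI[of _ C]) (auto simp: algebra_simps)
qed

lemma alexiewicz_norm_distr_deriv:
  assumes "a < b" "continuous_on {a..b} G"
  shows "alexiewicz_norm a b (distr_deriv a b G) =
     Sup {\<bar>G x - G y\<bar> | x y. x \<in> {a..b} \<and> y \<in> {a..b}}"
proof -
  obtain C where C: "\<And>x. x \<in> {a..b} \<Longrightarrow> distr_primitive a b (distr_deriv a b G) x = G x + C"
    using distr_primitive_distr_deriv[OF assms] by blast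
  show ?thesis
    unfolding alexiewicz_norm_def Let_def
    by (intro arg_cong[of _ _ Sup] Collect_cong ex_cong1) (auto simp: C)
qed

lemma denjoy_integral_distr_deriv_C1:
  assumes "a < b" and G: "continuous_on {a..b} G" and w': "continuous_on {a..b} w'"
    and w: "\<And>x. x \<in> {a..b} \<Longrightarrow> (w has_real_derivative w' x) (at x within {a..b})"
  shows "denjoy_integral a b (distr_deriv a b G) w =
     G b * w b - G a * w a - integral {a..b} (\<lambda>x. G x * w' x)"
proof -
  define H where "H = distr_primitive a b (distr_deriv a b G)"
  obtain C where C: "\<And>x. x \<in> {a..b} \<Longrightarrow> H x = G x + C"
    using distr_primitive_distr_deriv[OF assms(1) G] unfolding H_def by blast
  have "continuous_on {a..b} H"
    using C by (subst continuous_on_cong[OF refl C]) (auto intro!: continuous_intros G)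
  then have "rs_integral H w a b = integral {a..b} (\<lambda>x. H x * w' x)"
    by (intro rs_integralI has_rs_integral_C1 assms)
  also have "\<dots> = integral {a..b} (\<lambda>x. G x * w' x + C * w' x)"
    by (rule Henstock_Kurzweil_Integration.integral_cong) (simp add: C distrib_right)
  also have "\<dots> = integral {a..b} (\<lambda>x. G x * w' x) + integral {a..b} (\<lambda>x. C * w' x)"
    by (intro Henstock_Kurzweil_Integration.integral_add integrable_continuous_interval
        continuous_intros G w')
  also have "integral {a..b} (\<lambda>x. C * w' x) = C * (w b - w a)"
  proof (intro integral_unique has_integral_mult_right fundamental_theorem_of_calculus)
    show "(w has_vector_derivative w' x) (at x within {a..b})" if "x \<in> {a..b}" for x
      using w[OF that] by (simp add: has_real_derivative_iff_has_vector_derivative)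
  qed (use \<open>a < b\<close> in simp)
  finally show ?thesis
    using C[of a] C[of b] \<open>a < b\<close>
    by (simp add: denjoy_integral_def Let_def H_def[symmetric] algebra_simps)
qed


section \<open>The error term\<close>

text \<open>Derivatives are relative to the set, hence one-sided at the endpoints of an interval.\<close>

definition iter_deriv_on :: "real set \<Rightarrow> nat \<Rightarrow> (real \<Rightarrow> real) \<Rightarrow> real \<Rightarrow> real" where
  "iter_deriv_on S k = ((\<lambda>g x. vector_derivative g (at x within S)) ^^ k)"

definition iter_differentiable_on :: "real set \<Rightarrow> nat \<Rightarrow> (real \<Rightarrow> real) \<Rightarrow> bool" where
  "iter_differentiable_on S k f \<longleftrightarrow> (\<forall>j<k. iter_deriv_on S j f differentiable_on S)"

text \<open>The distribution $f^{(n)}$, and its pullback $x \mapsto f^{(n)}(a+(b-a)x)$ to $[0,1]$.\<close>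

definition top_deriv ::
    "real \<Rightarrow> real \<Rightarrow> nat \<Rightarrow> (real \<Rightarrow> real) \<Rightarrow> (real \<Rightarrow> real) \<Rightarrow> real" where
  "top_deriv a b n f = distr_deriv a b (iter_deriv_on {a..b} (n - 1) f)"

definition top_deriv_pullback ::
    "real \<Rightarrow> real \<Rightarrow> nat \<Rightarrow> (real \<Rightarrow> real) \<Rightarrow> (real \<Rightarrow> real) \<Rightarrow> real" where
  "top_deriv_pullback a b n f =
     distr_deriv 0 1 (\<lambda>x. iter_deriv_on {a..b} (n - 1) f (a + (b - a) * x) / (b - a))"

definition error_term :: "real \<Rightarrow> real \<Rightarrow> real poly \<Rightarrow> (real \<Rightarrow> real) \<Rightarrow> real" where
  "error_term a b p f = (let n = degree p in
     (-1) ^ n * (b - a) ^ (n + 1) * denjoy_integral 0 1 (top_deriv_pullback a b n f) (poly p))"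

lemma error_term_explicit:
  assumes "a < b" "degree p = n"
    and cont: "continuous_on {a..b} (iter_deriv_on {a..b} (n - 1) f)"
  defines "F \<equiv> iter_deriv_on {a..b} (n - 1) f"
  shows "error_term a b p f = (-1) ^ n * (b - a) ^ n *
    (poly p 1 * F b - poly p 0 * F a - integral {0..1} (\<lambda>x. F (a + (b - a) * x) * poly (pderiv p) x))"
proof -
  have "a + (b - a) * x \<in> {a..b}" if "x \<in> {0..1}" for x
  proof -
    have "0 \<le> (b - a) * x" "(b - a) * x \<le> b - a"
      using that \<open>a < b\<close> by (auto intro: mult_left_le)
    then show ?thesis by simp
  qed
  then have "continuous_on {0..1} (\<lambda>x. F (a + (b - a) * x))"
    unfolding F_def by (intro continuous_on_compose2[OF cont] continuous_intros) blast
  then have "continuous_on {0..1} (\<lambda>x. F (a + (b - a) * x) / (b - a))"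
    using \<open>a < b\<close> by (intro continuous_intros) auto
  then have "denjoy_integral 0 1 (top_deriv_pullback a b n f) (poly p) =
      F b / (b - a) * poly p 1 - F a / (b - a) * poly p 0
      - integral {0..1} (\<lambda>x. F (a + (b - a) * x) / (b - a) * poly (pderiv p) x)"
    unfolding top_deriv_pullback_def F_def[symmetric]
    by (subst denjoy_integral_distr_deriv_C1[where w' = "poly (pderiv p)"])
       (auto intro!: continuous_intros intro: has_field_derivative_at_within poly_DERIV)
  also have "integral {0..1} (\<lambda>x. F (a + (b - a) * x) / (b - a) * poly (pderiv p) x)
      = integral {0..1} (\<lambda>x. F (a + (b - a) * x) * poly (pderiv p) x) / (b - a)"
    by (subst integral_divide[symmetric]) simp
  finally have "(b - a) * denjoy_integral 0 1 (top_deriv_pullback a b n f) (poly p) =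
      poly p 1 * F b - poly p 0 * F a - integral {0..1} (\<lambda>x. F (a + (b - a) * x) * poly (pderiv p) x)"
    using \<open>a < b\<close> by (simp add: right_diff_distrib mult.commute)
  then show ?thesis
    using assms(2) by (simp add: error_term_def Let_def mult.assoc)
qed

end

theory Submission
  imports Defs
begin

text \<open>Write $p = p_n + c$ and let $r$ be a root of $p$ in $[0,1]$. Since $p(1) = \int_r^1 p'$ and
  $-p(0) = \int_0^r p'$, the bracket in the explicit form of the error term is
  $\int_r^1 (G(1) - G(x)) p'(x)\,dx + \int_0^r (G(0) - G(x)) p'(x)\,dx$ with
  $G(x) = f^{(n-1)}(a + (b-a)x)$. Both differences of $G$ are bounded by the Alexiewicz norm, and
  $\int_0^1 |p'| = V_{[0,1]} p_n$.\<close>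

text \<open>By the mean value theorem every variation sum of \<open>w\<close> is a Riemann sum of
  |w'| at suitable tags. On fine partitions these sums come close to the integral, and none of them
  exceeds the supremum. This is the half of the identity between integral and variation that an
  upper bound calls for.\<close>

lemma integral_abs_deriv_le_total_variation:
  assumes "a < b" and w': "continuous_on {a..b} w'"
    and w: "\<And>x. x \<in> {a..b} \<Longrightarrow> (w has_real_derivative w' x) (at x within {a..b})"
  shows "integral {a..b} (\<lambda>x. \<bar>w' x\<bar>) \<le> total_variation a b w"
proof -
  define S where "S = {\<Sum>i<N. \<bar>w (t (Suc i)) - w (t i)\<bar> | N t. partition_of_interval a b N t}"
  have sub: "{t i..t (Suc i)} \<subseteq> {a..b}" and lt: "t i < t (Suc i)"
    if "partition_of_interval a b N t" "i < N" for N t i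
    using partition_of_interval_mono[OF that(1), of 0 i]
      partition_of_interval_mono[OF that(1), of "Suc i" N] that
    by (auto simp: partition_of_interval_def)
  have mvt: "\<exists>s\<in>{t i..t (Suc i)}. w (t (Suc i)) - w (t i) = w' s * (t (Suc i) - t i)"
    if t: "partition_of_interval a b N t" "i < N" for N t i
  proof -
    have "(w has_derivative (*) (w' x)) (at x within {t i..t (Suc i)})"
      if "t i \<le> x" "x \<le> t (Suc i)" for x
      using DERIV_subset[OF w sub[OF t]] sub[OF t] that
      by (auto simp: has_field_derivative_def)
    from mvt_simple[OF lt[OF t] this] show ?thesis by force
  qed
  obtain M where M: "\<And>x. x \<in> {a..b} \<Longrightarrow> \<bar>w' x\<bar> \<le> M"
    using compact_imp_bounded[OF compact_continuous_image[OF w']] unfolding bounded_pos by fastforce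
  \<comment> \<open>A real \<open>Sup\<close> is informative only for a set bounded above; the bound
    \<open>M\<close> on the slopes provides this.\<close>
  have "y \<le> M * (b - a)" if yS: "y \<in> S" for y
  proof -
    obtain N t where t: "partition_of_interval a b N t"
      and y: "y = (\<Sum>i<N. \<bar>w (t (Suc i)) - w (t i)\<bar>)"
      using yS unfolding S_def by blast
    have "y \<le> (\<Sum>i<N. M * (t (Suc i) - t i))"
      unfolding y
    proof (rule sum_mono)
      fix i assume "i \<in> {..<N}"
      then have i: "i < N" by simp
      from mvt[OF t i] sub[OF t i] lt[OF t i] M
      show "\<bar>w (t (Suc i)) - w (t i)\<bar> \<le> M * (t (Suc i) - t i)"
        by (auto simp: abs_mult subset_iff intro!: mult_right_mono)
    qed
    also have "\<dots> = M * (b - a)"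
      using t by (simp add: sum_lessThan_telescope partition_of_interval_def
          flip: sum_distrib_left)
    finally show ?thesis .
  qed
  then have bdd: "bdd_above S" by (rule bdd_aboveI)
  \<comment> \<open>With the identity as integrator, Riemann-Stieltjes sums are the ordinary Riemann
    sums of |w'|. The factor 1 is the derivative of the identity.\<close>
  have "has_rs_integral (\<lambda>x. \<bar>w' x\<bar>) (\<lambda>x. x) a b (integral {a..b} (\<lambda>x. \<bar>w' x\<bar> * 1))"
    using \<open>a < b\<close> by (intro has_rs_integral_C1) (auto intro!: continuous_intros w')
  then have rs: "has_rs_integral (\<lambda>x. \<bar>w' x\<bar>) (\<lambda>x. x) a b (integral {a..b} (\<lambda>x. \<bar>w' x\<bar>))"
    by simp
  have "integral {a..b} (\<lambda>x. \<bar>w' x\<bar>) \<le> Sup S + e" if e: "e > 0" for e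
  proof -
    obtain d where d: "d > 0" "\<And>N t s. partition_of_interval a b N t \<and>
        (\<forall>i<N. t (Suc i) - t i < d \<and> s i \<in> {t i..t (Suc i)}) \<Longrightarrow>
        \<bar>(\<Sum>i<N. \<bar>w' (s i)\<bar> * (t (Suc i) - t i)) - integral {a..b} (\<lambda>x. \<bar>w' x\<bar>)\<bar> < e"
      using rs e unfolding has_rs_integral_def by meson
    obtain N t where t: "partition_of_interval a b N t" "\<And>i. i < N \<Longrightarrow> t (Suc i) - t i < d"
      using ex_fine_partition[OF \<open>a < b\<close> d(1)] by blast
    \<comment> \<open>Mean value points as tags make the Riemann sum equal to the variation sum, so
      the only error is the \<open>e\<close> between the Riemann sum and the integral.\<close>
    obtain s where s: "\<And>i. i < N \<Longrightarrow>
        s i \<in> {t i..t (Suc i)} \<and> w (t (Suc i)) - w (t i) = w' (s i) * (t (Suc i) - t i)"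
      using mvt[OF t(1)] by metis
    have "(\<Sum>i<N. \<bar>w' (s i)\<bar> * (t (Suc i) - t i)) = (\<Sum>i<N. \<bar>w (t (Suc i)) - w (t i)\<bar>)"
      using s lt[OF t(1)] by (intro sum.cong) (auto simp: abs_mult less_imp_le)
    also have "\<dots> \<le> Sup S"
      using t(1) by (intro cSup_upper bdd) (auto simp: S_def)
    finally show ?thesis using d(2)[of N t s] t s by fastforce
  qed
  then show ?thesis
    unfolding total_variation_def S_def[symmetric] by (rule field_le_epsilon)
qed

text \<open>The increment of \<open>w\<close> is the integral of \<open>w'\<close>, so the
  difference is the integral of \<open>(K - G x) * w' x\<close>, whose integrand is at most M |w'|.
  The case \<open>u = v\<close> is included because the root may be an endpoint.\<close>

lemma abs_increment_minus_integral_le: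
  fixes w w' G :: "real \<Rightarrow> real"
  assumes "u \<le> v" and G: "continuous_on {u..v} G" and w': "continuous_on {u..v} w'"
    and w: "\<And>x. x \<in> {u..v} \<Longrightarrow> (w has_real_derivative w' x) (at x within {u..v})"
    and M: "\<And>x. x \<in> {u..v} \<Longrightarrow> \<bar>K - G x\<bar> \<le> M"
  shows "\<bar>K * (w v - w u) - integral {u..v} (\<lambda>x. G x * w' x)\<bar>
    \<le> M * integral {u..v} (\<lambda>x. \<bar>w' x\<bar>)"
proof -
  have "(w' has_integral w v - w u) {u..v}"
    using assms by (intro fundamental_theorem_of_calculus)
      (auto simp flip: has_real_derivative_iff_has_vector_derivative)
  then have 1: "((\<lambda>x. K * w' x) has_integral K * (w v - w u)) {u..v}"
    by (rule has_integral_mult_right)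
  have 2: "((\<lambda>x. G x * w' x) has_integral integral {u..v} (\<lambda>x. G x * w' x)) {u..v}"
    by (intro integrable_integral integrable_continuous_interval continuous_intros G w')
  have eq: "K * (w v - w u) - integral {u..v} (\<lambda>x. G x * w' x)
      = integral {u..v} (\<lambda>x. (K - G x) * w' x)"
    using has_integral_diff[OF 1 2] by (simp add: left_diff_distrib integral_unique)
  have "norm (integral {u..v} (\<lambda>x. (K - G x) * w' x)) \<le> integral {u..v} (\<lambda>x. M * \<bar>w' x\<bar>)"
    using M by (intro integral_norm_bound_integral integrable_continuous_interval)
      (auto simp: abs_mult intro!: mult_right_mono continuous_intros G w')
  then show ?thesis by (simp add: eq)
qed

text \<open>Since \<open>w r = 0\<close>, the boundary terms are increments:
  \<open>G b * (w b - w r)\<close> and \<open>G a * (w r - w a)\<close>. The previous estimate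
  applies on [r,b] with \<open>K = G b\<close> and on [a,r] with \<open>K = G a\<close>. Both carry
  the same \<open>M\<close>, so the two bounds add up to one over [a,b].\<close>

lemma abs_integral_by_parts_le:
  fixes w w' G :: "real \<Rightarrow> real"
  assumes G: "continuous_on {a..b} G" and w': "continuous_on {a..b} w'"
    and w: "\<And>x. x \<in> {a..b} \<Longrightarrow> (w has_real_derivative w' x) (at x within {a..b})"
    and r: "r \<in> {a..b}" "w r = 0"
    and M: "\<And>x y. x \<in> {a..b} \<Longrightarrow> y \<in> {a..b} \<Longrightarrow> \<bar>G x - G y\<bar> \<le> M"
  shows "\<bar>G b * w b - G a * w a - integral {a..b} (\<lambda>x. G x * w' x)\<bar>
    \<le> M * integral {a..b} (\<lambda>x. \<bar>w' x\<bar>)"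
proof -
  have sub: "{a..r} \<subseteq> {a..b}" "{r..b} \<subseteq> {a..b}" using r by auto
  have "\<bar>G a * (w r - w a) - integral {a..r} (\<lambda>x. G x * w' x)\<bar>
      \<le> M * integral {a..r} (\<lambda>x. \<bar>w' x\<bar>)"
    using r by (intro abs_increment_minus_integral_le M DERIV_subset[OF w]
        continuous_on_subset[OF G] continuous_on_subset[OF w']) auto
  moreover have "\<bar>G b * (w b - w r) - integral {r..b} (\<lambda>x. G x * w' x)\<bar>
      \<le> M * integral {r..b} (\<lambda>x. \<bar>w' x\<bar>)"
    using r by (intro abs_increment_minus_integral_le M DERIV_subset[OF w]
        continuous_on_subset[OF G] continuous_on_subset[OF w']) auto
  moreover have "integral {a..b} h = integral {a..r} h + integral {r..b} h"
    if "continuous_on {a..b} h" for h :: "real \<Rightarrow> real"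
    using r that by (intro Henstock_Kurzweil_Integration.integral_combine[symmetric]
        integrable_continuous_interval) auto
  from this[of "\<lambda>x. G x * w' x"] this[of "\<lambda>x. \<bar>w' x\<bar>"]
  have "integral {a..b} (\<lambda>x. G x * w' x)
        = integral {a..r} (\<lambda>x. G x * w' x) + integral {r..b} (\<lambda>x. G x * w' x)"
      "integral {a..b} (\<lambda>x. \<bar>w' x\<bar>)
        = integral {a..r} (\<lambda>x. \<bar>w' x\<bar>) + integral {r..b} (\<lambda>x. \<bar>w' x\<bar>)"
    by (auto intro!: continuous_intros G w')
  ultimately show ?thesis using r(2) by (simp add: distrib_left)
qed

text \<open>The chosen primitive differs from \<open>G\<close> by a constant on [a,b], which cancels
  in differences. The real \<open>Sup\<close> dominates its members once boundedness is known;
  continuity on a compact interval gives that.\<close>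

lemma abs_diff_le_alexiewicz_norm:
  assumes "a < b" and G: "continuous_on {a..b} G" and "x \<in> {a..b}" "y \<in> {a..b}"
  shows "\<bar>G x - G y\<bar> \<le> alexiewicz_norm a b (distr_deriv a b G)"
proof -
  obtain B where "\<And>x. x \<in> {a..b} \<Longrightarrow> \<bar>G x\<bar> \<le> B"
    using compact_imp_bounded[OF compact_continuous_image[OF G]] unfolding bounded_pos by fastforce
  then have "\<bar>G u - G v\<bar> \<le> B + B" if "u \<in> {a..b}" "v \<in> {a..b}" for u v
    using that by (smt (verit))
  then have "bdd_above {\<bar>G x - G y\<bar> | x y. x \<in> {a..b} \<and> y \<in> {a..b}}"
    by (intro bdd_aboveI[of _ "B + B"]) blast
  then show ?thesis
    unfolding alexiewicz_norm_distr_deriv[OF assms(1,2)]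
    using assms(3,4) by (intro cSup_upper) auto
qed

theorem mainTheorem11:
  fixes n :: nat and a b c :: real and f :: "real \<Rightarrow> real"
  assumes "n \<ge> 1" and "a < b"
    and "iter_differentiable_on {a..b} (n - 1) f"
    and "continuous_on {a..b} (iter_deriv_on {a..b} (n - 1) f)"
    and "\<exists>r\<in>{0..1}. poly (normalized_bernpoly n + [:c:]) r = 0"
  shows "\<bar>error_term a b (normalized_bernpoly n + [:c:]) f\<bar>
    \<le> (b - a) ^ n * alexiewicz_norm a b (top_deriv a b n f)
        * total_variation 0 1 (poly (normalized_bernpoly n))"
proof -
  define F where "F = iter_deriv_on {a..b} (n - 1) f"
  define M where "M = alexiewicz_norm a b (top_deriv a b n f)"
  define G where "G x = F (a + (b - a) * x)" for x
  define p where "p = normalized_bernpoly n + [:c:]"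
  have F: "continuous_on {a..b} F" using assms(4) by (simp add: F_def)
  have FM: "\<bar>F x - F y\<bar> \<le> M" if "x \<in> {a..b}" "y \<in> {a..b}" for x y
    unfolding M_def top_deriv_def F_def[symmetric]
    by (rule abs_diff_le_alexiewicz_norm[OF \<open>a < b\<close> F that])
  have in_ab: "a + (b - a) * x \<in> {a..b}" if "x \<in> {0..1}" for x
  proof -
    have "0 \<le> (b - a) * x" "(b - a) * x \<le> b - a"
      using that \<open>a < b\<close> by (auto intro: mult_left_le)
    then show ?thesis by simp
  qed
  have G: "continuous_on {0..1} G"
    unfolding G_def by (intro continuous_on_compose2[OF F] continuous_intros) (use in_ab in blast)
  \<comment> \<open>The affine map carries [0,1] into [a,b], so every difference of values of
    \<open>G\<close> is one of \<open>F\<close>.\<close>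
  have GM: "\<bar>G x - G y\<bar> \<le> M" if "x \<in> {0..1}" "y \<in> {0..1}" for x y
    unfolding G_def using that by (intro FM in_ab)
  \<comment> \<open>The sign allows the variation bound to be multiplied by \<open>M\<close> in the
    last step.\<close>
  have "M \<ge> 0" using FM[of a a] \<open>a < b\<close> by simp
  obtain r where r: "r \<in> {0..1}" "poly p r = 0" using assms(5) by (auto simp: p_def)
  \<comment> \<open>\<open>error_term\<close> takes its order from \<open>degree p\<close>, which is
    \<open>n\<close> because adding a constant to a polynomial of degree n \<ge> 1 keeps the degree.
    The factor 1/(b-a) in the pullback lowers the exponent from n+1 to n.\<close>
  have err: "error_term a b p f = (-1) ^ n * (b - a) ^ n *
      (G 1 * poly p 1 - G 0 * poly p 0 - integral {0..1} (\<lambda>x. G x * poly (pderiv p) x))"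
    using error_term_explicit[of a b p n f] assms degree_normalized_bernpoly_plus[of n c]
    by (simp add: G_def F_def p_def mult.commute)
  have "\<bar>error_term a b p f\<bar> = (b - a) ^ n *
      \<bar>G 1 * poly p 1 - G 0 * poly p 0 - integral {0..1} (\<lambda>x. G x * poly (pderiv p) x)\<bar>"
    unfolding err using \<open>a < b\<close> by (simp add: abs_mult power_abs)
  also have "\<dots> \<le> (b - a) ^ n * (M * integral {0..1} (\<lambda>x. \<bar>poly (pderiv p) x\<bar>))"
    using \<open>a < b\<close> r
    by (intro mult_left_mono abs_integral_by_parts_le[where r = r] G GM)
      (auto intro!: continuous_intros has_field_derivative_at_within poly_DERIV)
  \<comment> \<open>The constant \<open>c\<close> disappears on differentiation, so the final bound
    involves the variation of p_n itself.\<close>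
  also have "pderiv p = pderiv (normalized_bernpoly n)"
    by (simp add: p_def pderiv_add pderiv_pCons)
  also have "(b - a) ^ n * (M * integral {0..1} (\<lambda>x. \<bar>poly (pderiv (normalized_bernpoly n)) x\<bar>))
      \<le> (b - a) ^ n * (M * total_variation 0 1 (poly (normalized_bernpoly n)))"
    using \<open>a < b\<close> \<open>M \<ge> 0\<close>
    by (intro mult_left_mono integral_abs_deriv_le_total_variation)
      (auto intro!: continuous_intros has_field_derivative_at_within poly_DERIV)
  finally show ?thesis by (simp add: M_def p_def mult.assoc)
qed

end
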